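(* Let $X$ be a Banach space, let $A:D(A)\to X$ be a linear operator that generates a $C^0$-semigroup $(e^{tA})_{t\ge 0}$ of bounded linear operators on $X$, and let $B:X\to X$ be a bounded linear operator. Then, for every $\psi_0$ in $X$, the attainable set $$\mathcal{A}(\psi_0,L^1_{loc}([0,+\infty),\mathbf{R}))=\bigcup_{T\ge 0}\ \bigcup_{u\in L^1_{loc}([0,+\infty),\mathbf{R})}\{\Upsilon^u_{T,0}\psi_0\}$$ is contained in a countable union of compact subsets of $X$.
   Context: Consider the bilinear control system $\dot\psi(t)=A\psi(t)+u(t)B\psi(t)$, $\psi(0)=\psi_0$, with scalar control $u:[0,+\infty)\to\mathbf{R}$. A function $\psi:[0,T]\to X$ is a mild solution if for every $t\in[0,T]$, $$\psi(t)=e^{tA}\psi_0+\int_0^t e^{(t-s)A}B\psi(s)u(s)\,\mathrm{d}s .$$ For every $\psi_0\in X$ and every $u\in L^1_{loc}([0,+\infty),\mathbf{R})$ there exists a unique (continuous) mild solution on $[0,+\infty)$ (a known result); it is denoted $t\mapsto \Upsilon^u_{t,0}\psi_0$. *)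

theory Defs
  imports "HOL-Analysis.Analysis"
begin

definition linear_operator_on :: "'a::real_vector set \<Rightarrow> ('a \<Rightarrow> 'a) \<Rightarrow> bool" where
  "linear_operator_on D A \<longleftrightarrow> subspace D \<and>
     (\<forall>x\<in>D. \<forall>y\<in>D. A (x + y) = A x + A y) \<and> (\<forall>c. \<forall>x\<in>D. A (c *\<^sub>R x) = c *\<^sub>R A x)"

text \<open>Only the operators \<open>S t\<close> with \<open>t \<ge> 0\<close> are constrained; the values of \<open>S\<close> at negative
  times are irrelevant here and below.\<close>

definition C0_semigroup :: "(real \<Rightarrow> 'a::real_normed_vector \<Rightarrow>\<^sub>L 'a) \<Rightarrow> bool" where
  "C0_semigroup S \<longleftrightarrow>
     S 0 = id_blinfun \<and>
     (\<forall>s\<ge>0. \<forall>t\<ge>0. S (s + t) = S s o\<^sub>L S t) \<and>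
     (\<forall>x. ((\<lambda>t. S t x) \<longlongrightarrow> x) (at_right 0))"

text \<open>The operator \<open>A\<close> with domain \<open>D\<close> is the infinitesimal generator of \<open>S\<close>, so that
  \<open>S t\<close> plays the role of $e^{tA}$. Values of \<open>A\<close> outside \<open>D\<close> are irrelevant.\<close>

definition generates_C0_semigroup ::
    "'a::real_normed_vector set \<Rightarrow> ('a \<Rightarrow> 'a) \<Rightarrow> (real \<Rightarrow> 'a \<Rightarrow>\<^sub>L 'a) \<Rightarrow> bool" where
  "generates_C0_semigroup D A S \<longleftrightarrow>
     C0_semigroup S \<and>
     D = {x. \<exists>y. ((\<lambda>h. (S h x - x) /\<^sub>R h) \<longlongrightarrow> y) (at_right 0)} \<and>
     (\<forall>x\<in>D. ((\<lambda>h. (S h x - x) /\<^sub>R h) \<longlongrightarrow> A x) (at_right 0))"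

text \<open>The library's \<^const>\<open>has_bochner_integral\<close> is restricted to second countable (that is,
  separable) codomains. The following is the same definition without that restriction, so that
  arbitrary Banach spaces are covered.\<close>

definition has_bochner_integral_gen ::
    "'a measure \<Rightarrow> ('a \<Rightarrow> 'b::real_normed_vector) \<Rightarrow> 'b \<Rightarrow> bool" where
  "has_bochner_integral_gen M f x \<longleftrightarrow>
     f \<in> borel_measurable M \<and>
     (\<exists>s. (\<forall>i. Bochner_Integration.simple_bochner_integrable M (s i)) \<and>
          ((\<lambda>i. \<integral>\<^sup>+y. norm (f y - s i y) \<partial>M) \<longlonglongrightarrow> 0) \<and>
          ((\<lambda>i. Bochner_Integration.simple_bochner_integral M (s i)) \<longlonglongrightarrow> x))"

lemma has_bochner_integral_gen_eq:
  fixes f :: "'a \<Rightarrow> 'b::{real_normed_vector, second_countable_topology}"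
  shows "has_bochner_integral_gen M f x \<longleftrightarrow> has_bochner_integral M f x"
  unfolding has_bochner_integral_gen_def has_bochner_integral.simps by blast

text \<open>Controls are represented by functions on all of \<open>\<real>\<close>, of which only the restriction to
  $[0,+\infty)$ matters.\<close>

definition L1_loc :: "(real \<Rightarrow> real) set" where
  "L1_loc = {u. \<forall>T\<ge>0. set_integrable lebesgue {0..T} u}"

text \<open>The time interval \<open>I\<close> is meant to be \<open>{0..T}\<close> or \<open>{0..}\<close>.\<close>

definition mild_solution_on ::
    "real set \<Rightarrow> (real \<Rightarrow> 'a::real_normed_vector \<Rightarrow>\<^sub>L 'a) \<Rightarrow> ('a \<Rightarrow>\<^sub>L 'a) \<Rightarrow> (real \<Rightarrow> real) \<Rightarrow> 'a
       \<Rightarrow> (real \<Rightarrow> 'a) \<Rightarrow> bool" where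
  "mild_solution_on I S B u \<psi>0 \<psi> \<longleftrightarrow>
     continuous_on I \<psi> \<and>
     (\<forall>t\<in>I. \<exists>y. has_bochner_integral_gen (lebesgue_on {0..t})
                  (\<lambda>s. u s *\<^sub>R S (t - s) (B (\<psi> s))) y \<and>
                \<psi> t = S t \<psi>0 + y)"

text \<open>The value at time \<open>t\<close> of the unique mild solution on $[0,+\infty)$. The description ranges
  over values rather than functions because \<open>\<psi>\<close> is not determined at negative times.\<close>

definition propagator ::
    "(real \<Rightarrow> 'a::real_normed_vector \<Rightarrow>\<^sub>L 'a) \<Rightarrow> ('a \<Rightarrow>\<^sub>L 'a) \<Rightarrow> (real \<Rightarrow> real) \<Rightarrow> real \<Rightarrow> 'a \<Rightarrow> 'a" where
  "propagator S B u t \<psi>0 = (THE x. \<exists>\<psi>. mild_solution_on {0..} S B u \<psi>0 \<psi> \<and> \<psi> t = x)"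

definition attainable_set ::
    "(real \<Rightarrow> 'a::real_normed_vector \<Rightarrow>\<^sub>L 'a) \<Rightarrow> ('a \<Rightarrow>\<^sub>L 'a) \<Rightarrow> 'a \<Rightarrow> (real \<Rightarrow> real) set \<Rightarrow> 'a set" where
  "attainable_set S B \<psi>0 U = (\<Union>T\<in>{0..}. \<Union>u\<in>U. {propagator S B u T \<psi>0})"

end

theory Submission
  imports Defs
begin

text \<open>
  Fix \<open>T\<close> and let \<open>M\<close> bound the semigroup on \<open>{0..T}\<close>. A mild solution is
  $\psi(t) = S(t)\psi_0 + \int_0^t u(s)\,S(t-s)B\psi(s)\,ds$. By strong
  continuity, the vectors \<open>S \<tau> (B x)\<close> with \<open>\<tau>\<close> in \<open>{0..T}\<close> and \<open>x\<close> in a compact set form a compact set.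
  So if the states \<open>\<psi> s\<close> stay in a compact set and \<open>\<integral>\<bar>u\<bar>\<close> stays bounded, the integral takes values
  in a compact set, a multiple of a closed convex hull. The
  difficulty is the circularity: the states under the integral are those to be estimated.

  It is resolved by counting time in units of control mass. Choose \<open>\<epsilon>\<close> with
  \<open>M * norm B * \<epsilon> \<le> 1 / 2\<close> and let \<open>R j\<close> be the set of all states reached at times \<open>t \<le> T\<close> with
  \<open>\<integral>\<bar>u\<bar> < j * \<epsilon>\<close> over \<open>{0..t}\<close>. For a state in \<open>R (j + 1)\<close> the integral splits into an early part, with
  states in \<open>R j\<close>, and a late part, with states in \<open>R (j + 1)\<close> and control mass at most \<open>\<epsilon>\<close>. If \<open>R j\<close>
  is totally bounded, the early part is harmless, and the late part contracts the measure of
  noncompactness \<open>\<alpha>\<close>: formally \<open>\<alpha> (R (j + 1)) \<le> 1 / 2 * \<alpha> (R (j + 1))\<close>, so \<open>\<alpha> (R (j + 1)) = 0\<close>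
  because \<open>R (j + 1)\<close> is bounded. In the quantitative form \<open>reachable_refine_cover\<close> a finite cover by
  balls of radius \<open>r\<close> is turned into one of radius \<open>3 / 4 * r\<close>; its main tool is
  \<open>ex_bounded_combination_integral_near\<close>. Boundedness of \<open>R j\<close> and uniqueness of mild solutions both
  come from \<open>mild_solution_on_Lipschitz\<close>, which rests on the same splitting, now in the form of a
  Gronwall inequality.

  Hence for all natural \<open>n\<close> the states reached up to time \<open>n\<close> with control mass below \<open>n\<close> have compact
  closure. Together with the single default point of the propagator, these closures cover the
  attainable set.
\<close>

section \<open>Integration without separability\<close>

text \<open>In a non-separable space, sums of Borel measurable functions need not be measurable, so the
  Bochner integral in the definition of mild solutions is not obviously additive. The relation below
  replaces measurability of the integrand by a measurable majorant \<open>e i\<close> of the approximation error;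
  in this form the integral is additive, and its norm is bounded by the integral of any measurable
  majorant of the norm of the integrand.\<close>

definition approx_integral :: "'a measure \<Rightarrow> ('a \<Rightarrow> 'b::real_normed_vector) \<Rightarrow> 'b \<Rightarrow> bool" where
  "approx_integral M f y \<longleftrightarrow>
     (\<exists>s e. (\<forall>i. Bochner_Integration.simple_bochner_integrable M (s i)) \<and>
          (\<forall>i. e i \<in> borel_measurable M) \<and>
          (\<forall>i. \<forall>x\<in>space M. ennreal (norm (f x - s i x)) \<le> e i x) \<and>
          ((\<lambda>i. \<integral>\<^sup>+x. e i x \<partial>M) \<longlonglongrightarrow> 0) \<and>
          ((\<lambda>i. Bochner_Integration.simple_bochner_integral M (s i)) \<longlonglongrightarrow> y))"

text \<open>Holds without separability because \<open>s\<close> takes only finitely many values: on each of its level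
  sets, the norm measures the distance of \<open>f\<close> from a fixed vector.\<close>

lemma borel_measurable_norm_diff_simple:
  fixes f s :: "'a \<Rightarrow> 'b::real_normed_vector"
  assumes f[measurable]: "f \<in> borel_measurable M" and s: "simple_function M s"
  shows "(\<lambda>x. norm (f x - s x)) \<in> borel_measurable M"
proof (rule borel_measurableI_le)
  fix a :: real
  have fin: "finite (s ` space M)"
    by (rule simple_functionD(1)[OF s])
  have sv: "{x \<in> space M. s x = v} \<in> sets M" for v
    using simple_functionD(2)[OF s, of "{v}"] by (simp add: vimage_def Int_def conj_commute)
  have "{x \<in> space M. norm (f x - s x) \<le> a} =
      (\<Union>v\<in>s ` space M. {x \<in> space M. s x = v} \<inter> (f -` cball v a \<inter> space M))"
    by (auto simp: dist_norm norm_minus_commute)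
  also have "\<dots> \<in> sets M"
    using fin sv by (intro sets.finite_UN sets.Int measurable_sets[OF f]) auto
  finally show "{x \<in> space M. norm (f x - s x) \<le> a} \<in> sets M" .
qed

lemma approx_integral_has_bochner_integral_gen:
  assumes "has_bochner_integral_gen M f y"
  shows "approx_integral M f y"
proof -
  from assms obtain s where f: "f \<in> borel_measurable M"
    and s: "\<And>i. Bochner_Integration.simple_bochner_integrable M (s i)"
    and lim: "(\<lambda>i. \<integral>\<^sup>+x. norm (f x - s i x) \<partial>M) \<longlonglongrightarrow> 0"
      "(\<lambda>i. Bochner_Integration.simple_bochner_integral M (s i)) \<longlonglongrightarrow> y"
    unfolding has_bochner_integral_gen_def by blast
  have "(\<lambda>x. ennreal (norm (f x - s i x))) \<in> borel_measurable M" for i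
    using borel_measurable_norm_diff_simple[OF f] s[of i]
    by (auto elim: simple_bochner_integrable.cases)
  with s lim show ?thesis
    unfolding approx_integral_def
    by (intro exI[of _ s] exI[of _ "\<lambda>i x. ennreal (norm (f x - s i x))"]) auto
qed

lemma approx_integral_zero: "approx_integral M (\<lambda>x. 0) 0"
  unfolding approx_integral_def
  by (intro exI[of _ "\<lambda>i x. 0"])
     (auto simp: simple_bochner_integrable.simps Bochner_Integration.simple_bochner_integral_def image_constant_conv)

lemma approx_integral_add:
  assumes "approx_integral M f y" "approx_integral M g z"
  shows "approx_integral M (\<lambda>x. f x + g x) (y + z)"
proof -
  from assms obtain s e s' e' where
    s: "\<And>i. Bochner_Integration.simple_bochner_integrable M (s i)"
       "\<And>i. Bochner_Integration.simple_bochner_integrable M (s' i)"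
    and e[measurable]: "\<And>i. e i \<in> borel_measurable M" "\<And>i. e' i \<in> borel_measurable M"
    and le: "\<And>i x. x \<in> space M \<Longrightarrow> ennreal (norm (f x - s i x)) \<le> e i x"
       "\<And>i x. x \<in> space M \<Longrightarrow> ennreal (norm (g x - s' i x)) \<le> e' i x"
    and lim: "(\<lambda>i. \<integral>\<^sup>+x. e i x \<partial>M) \<longlonglongrightarrow> 0" "(\<lambda>i. \<integral>\<^sup>+x. e' i x \<partial>M) \<longlonglongrightarrow> 0"
       "(\<lambda>i. Bochner_Integration.simple_bochner_integral M (s i)) \<longlonglongrightarrow> y"
       "(\<lambda>i. Bochner_Integration.simple_bochner_integral M (s' i)) \<longlonglongrightarrow> z"
    unfolding approx_integral_def by metis
  show ?thesis
    unfolding approx_integral_def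
  proof (intro exI[of _ "\<lambda>i x. s i x + s' i x"] exI[of _ "\<lambda>i x. e i x + e' i x"] conjI allI ballI)
    fix i x assume x: "x \<in> space M"
    have "ennreal (norm (f x + g x - (s i x + s' i x))) \<le> ennreal (norm (f x - s i x) + norm (g x - s' i x))"
      by (intro ennreal_leI norm_diff_triangle_ineq)
    also have "\<dots> \<le> e i x + e' i x"
      using le[OF x, of i] by (simp add: add_mono)
    finally show "ennreal (norm (f x + g x - (s i x + s' i x))) \<le> e i x + e' i x" .
  next
    show "(\<lambda>i. \<integral>\<^sup>+x. e i x + e' i x \<partial>M) \<longlonglongrightarrow> 0"
      using tendsto_add[OF lim(1,2)] by (simp add: nn_integral_add)
    show "(\<lambda>i. Bochner_Integration.simple_bochner_integral M (\<lambda>x. s i x + s' i x)) \<longlonglongrightarrow> y + z"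
      using tendsto_add[OF lim(3,4)] s by (simp add: simple_bochner_integral_add)
  qed (use s e in \<open>auto intro: simple_bochner_integrable_compose2\<close>)
qed

lemma approx_integral_sum:
  assumes "\<And>c. c \<in> F \<Longrightarrow> approx_integral M (f c) (y c)"
  shows "approx_integral M (\<lambda>x. \<Sum>c\<in>F. f c x) (\<Sum>c\<in>F. y c)"
  using assms by (induction F rule: infinite_finite_induct) (auto intro: approx_integral_zero approx_integral_add)

lemma approx_integral_scaleR_left:
  fixes v :: "'a \<Rightarrow> real" and c :: "'b::real_normed_vector"
  assumes "integrable M v"
  shows "approx_integral M (\<lambda>x. v x *\<^sub>R c) (integral\<^sup>L M v *\<^sub>R c)"
proof -
  from has_bochner_integral_integrable[OF assms]
  obtain s where v[measurable]: "v \<in> borel_measurable M"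
    and s: "\<And>i. Bochner_Integration.simple_bochner_integrable M (s i)"
    and lim: "(\<lambda>i. \<integral>\<^sup>+x. norm (v x - s i x) \<partial>M) \<longlonglongrightarrow> 0"
      "(\<lambda>i. Bochner_Integration.simple_bochner_integral M (s i)) \<longlonglongrightarrow> integral\<^sup>L M v"
    unfolding has_bochner_integral.simps by blast
  have [measurable]: "s i \<in> borel_measurable M" for i
    using s[of i] by (auto intro: borel_measurable_simple_function elim: simple_bochner_integrable.cases)
  show ?thesis
    unfolding approx_integral_def
  proof (intro exI[of _ "\<lambda>i x. s i x *\<^sub>R c"]
      exI[of _ "\<lambda>i x. ennreal (norm c) * ennreal (norm (v x - s i x))"] conjI allI ballI)
    show "Bochner_Integration.simple_bochner_integrable M (\<lambda>x. s i x *\<^sub>R c)" for i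
      using simple_bochner_integrable_compose2[OF _ s s, of "\<lambda>x y. x *\<^sub>R c" i i] by simp
    show "(\<lambda>i. \<integral>\<^sup>+x. ennreal (norm c) * ennreal (norm (v x - s i x)) \<partial>M) \<longlonglongrightarrow> 0"
      using ennreal_tendsto_cmult[OF _ lim(1), of "ennreal (norm c)"]
      by (simp add: nn_integral_cmult)
    have "linear (\<lambda>r. r *\<^sub>R c)" by (rule linear_scaleR_left)
    from simple_bochner_integral_linear[OF this s]
    show "(\<lambda>i. Bochner_Integration.simple_bochner_integral M (\<lambda>x. s i x *\<^sub>R c)) \<longlonglongrightarrow> integral\<^sup>L M v *\<^sub>R c"
      using tendsto_scaleR[OF lim(2) tendsto_const[of c]] by simp
  qed (auto simp: ennreal_mult[symmetric] mult.commute simp flip: scaleR_diff_left)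
qed

text \<open>Two integrals are compared through their simple approximations, whose difference is simple and
  hence has a measurable norm; the triangle inequality then involves only measurable majorants.\<close>

lemma approx_integral_norm_diff_le:
  assumes "approx_integral M f y" "approx_integral M g z"
    and b[measurable]: "b \<in> borel_measurable M"
    and fg: "\<And>x. x \<in> space M \<Longrightarrow> ennreal (norm (f x - g x)) \<le> b x"
  shows "ennreal (norm (y - z)) \<le> (\<integral>\<^sup>+x. b x \<partial>M)"
proof -
  from assms obtain s e s' e' where
    s: "\<And>i. Bochner_Integration.simple_bochner_integrable M (s i)"
       "\<And>i. Bochner_Integration.simple_bochner_integrable M (s' i)"
    and e[measurable]: "\<And>i. e i \<in> borel_measurable M" "\<And>i. e' i \<in> borel_measurable M"
    and le: "\<And>i x. x \<in> space M \<Longrightarrow> ennreal (norm (f x - s i x)) \<le> e i x"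
       "\<And>i x. x \<in> space M \<Longrightarrow> ennreal (norm (g x - s' i x)) \<le> e' i x"
    and lim: "(\<lambda>i. \<integral>\<^sup>+x. e i x \<partial>M) \<longlonglongrightarrow> 0" "(\<lambda>i. \<integral>\<^sup>+x. e' i x \<partial>M) \<longlonglongrightarrow> 0"
       "(\<lambda>i. Bochner_Integration.simple_bochner_integral M (s i)) \<longlonglongrightarrow> y"
       "(\<lambda>i. Bochner_Integration.simple_bochner_integral M (s' i)) \<longlonglongrightarrow> z"
    unfolding approx_integral_def by metis
  let ?I = "Bochner_Integration.simple_bochner_integral M"
  have "ennreal (norm (?I (s i) - ?I (s' i))) \<le> (\<integral>\<^sup>+x. e i x \<partial>M) + (\<integral>\<^sup>+x. e' i x \<partial>M) + (\<integral>\<^sup>+x. b x \<partial>M)" for i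
  proof -
    have sd: "Bochner_Integration.simple_bochner_integrable M (\<lambda>x. s i x - s' i x)"
      using s by (auto intro: simple_bochner_integrable_compose2)
    have sn: "Bochner_Integration.simple_bochner_integrable M (\<lambda>x. norm (s i x - s' i x))"
      using simple_bochner_integrable_compose2[of "\<lambda>x y. norm (x - y)" M "s i" "s' i"] s by auto
    have "ennreal (norm (?I (s i) - ?I (s' i))) = norm (?I (\<lambda>x. s i x - s' i x))"
      using s by (simp add: simple_bochner_integral_diff)
    also have "\<dots> \<le> ?I (\<lambda>x. norm (s i x - s' i x))"
      by (intro ennreal_leI simple_bochner_integral_norm_bound sd)
    also have "\<dots> = (\<integral>\<^sup>+x. norm (s i x - s' i x) \<partial>M)"
      using sn by (intro simple_bochner_integral_eq_nn_integral) auto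
    also have "\<dots> \<le> (\<integral>\<^sup>+x. e i x + e' i x + b x \<partial>M)"
    proof (rule nn_integral_mono)
      fix x assume x: "x \<in> space M"
      have "norm (s i x - s' i x) \<le> norm (f x - s i x) + norm (g x - s' i x) + norm (f x - g x)"
        using norm_triangle_ineq4[of "f x - g x - (f x - s i x)" "- (g x - s' i x)"]
          norm_triangle_ineq4[of "f x - g x" "f x - s i x"]
        by (simp add: norm_minus_commute)
      then have "ennreal (norm (s i x - s' i x))
          \<le> ennreal (norm (f x - s i x) + norm (g x - s' i x) + norm (f x - g x))"
        by (rule ennreal_leI)
      also have "\<dots> \<le> e i x + e' i x + b x"
        using le[OF x, of i] fg[OF x] by (simp add: add_mono)
      finally show "ennreal (norm (s i x - s' i x)) \<le> e i x + e' i x + b x" .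
    qed
    also have "\<dots> = (\<integral>\<^sup>+x. e i x \<partial>M) + (\<integral>\<^sup>+x. e' i x \<partial>M) + (\<integral>\<^sup>+x. b x \<partial>M)"
      by (simp add: nn_integral_add)
    finally show ?thesis .
  qed
  moreover have "(\<lambda>i. ennreal (norm (?I (s i) - ?I (s' i)))) \<longlonglongrightarrow> ennreal (norm (y - z))"
    by (intro tendsto_ennrealI tendsto_norm tendsto_diff lim)
  moreover have "(\<lambda>i. (\<integral>\<^sup>+x. e i x \<partial>M) + (\<integral>\<^sup>+x. e' i x \<partial>M) + (\<integral>\<^sup>+x. b x \<partial>M))
      \<longlonglongrightarrow> 0 + 0 + (\<integral>\<^sup>+x. b x \<partial>M)"
    by (intro tendsto_add lim tendsto_const)
  ultimately show ?thesis
    by (intro LIMSEQ_le[where X="\<lambda>i. ennreal (norm (?I (s i) - ?I (s' i)))"]) auto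
qed

lemma approx_integral_norm_diff_le_integral:
  fixes b :: "'a \<Rightarrow> real"
  assumes "approx_integral M f y" "approx_integral M g z" and b: "integrable M b"
    and fg: "\<And>x. x \<in> space M \<Longrightarrow> norm (f x - g x) \<le> b x"
  shows "norm (y - z) \<le> integral\<^sup>L M b"
proof -
  have nn: "x \<in> space M \<Longrightarrow> 0 \<le> b x" for x
    using fg[of x] norm_ge_zero[of "f x - g x"] by linarith
  have "ennreal (norm (y - z)) \<le> (\<integral>\<^sup>+x. ennreal (b x) \<partial>M)"
    using assms by (intro approx_integral_norm_diff_le) (auto intro: ennreal_leI)
  also have "\<dots> = ennreal (integral\<^sup>L M b)"
    using b nn by (intro nn_integral_eq_integral) (auto intro: AE_I2)
  finally show ?thesis
    using nn by (subst (asm) ennreal_le_iff) (auto intro!: integral_nonneg_AE AE_I2)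
qed

section \<open>Strongly continuous semigroups\<close>

text \<open>The uniform boundedness principle, in the form needed at time 0: by strong continuity, the closed
  sets \<open>C n\<close> of vectors whose orbit is bounded by \<open>n\<close> up to time \<open>1 / (n + 1)\<close> cover the space, so by
  Baire's theorem one of them contains a ball.\<close>

lemma C0_semigroup_bounded_near_zero:
  fixes S :: "real \<Rightarrow> 'a::banach \<Rightarrow>\<^sub>L 'a"
  assumes "C0_semigroup S"
  shows "\<exists>\<delta>>0. \<exists>M. \<forall>t\<in>{0..\<delta>}. norm (S t) \<le> M"
proof -
  have S0: "S 0 = id_blinfun" and lim: "\<And>x. ((\<lambda>t. S t x) \<longlongrightarrow> x) (at_right 0)"
    using assms by (auto simp: C0_semigroup_def)
  define C where "C n = {x. \<forall>t\<in>{0..1 / real (Suc n)}. norm (S t x) \<le> real n}" for n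
  have clC: "closed (C n)" for n
  proof -
    have "C n = (\<Inter>t\<in>{0..1 / real (Suc n)}. {x. norm (S t x) \<le> real n})"
      by (auto simp: C_def)
    also have "closed \<dots>"
      by (intro closed_INT ballI closed_Collect_le continuous_intros)
    finally show ?thesis .
  qed
  have cover: "(\<Union>n. C n) = UNIV"
  proof -
    have "\<exists>n. x \<in> C n" for x
    proof -
      from lim[of x] have "\<forall>\<^sub>F t in at_right 0. dist (S t x) x < 1"
        by (rule tendstoD) simp
      then obtain \<delta> where \<delta>: "\<delta> > 0" "\<And>t. 0 < t \<Longrightarrow> t < \<delta> \<Longrightarrow> dist (S t x) x < 1"
        by (auto simp: eventually_at_right_field)
      obtain n1 where n1: "norm x + 1 < real n1" using reals_Archimedean2 by blast
      obtain n2 where n2: "1 / real (Suc n2) < \<delta>" using \<delta>(1) nat_approx_posE by blast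
      let ?n = "max n1 n2"
      have "x \<in> C ?n" unfolding C_def
      proof safe
        fix t :: real assume t: "t \<in> {0..1 / real (Suc ?n)}"
        have "1 / real (Suc ?n) \<le> 1 / real (Suc n2)" by (intro divide_left_mono) auto
        then have t': "t = 0 \<or> 0 < t \<and> t < \<delta>" using t n2 by auto
        have "norm (S t x) \<le> norm x + 1"
          using t' norm_triangle_ineq2[of "S t x" x] by (auto simp: S0 dest!: \<delta>(2) simp: dist_norm)
        then show "norm (S t x) \<le> real ?n" using n1 by linarith
      qed
      then show ?thesis by blast
    qed
    then show ?thesis by blast
  qed
  have "\<exists>n. interior (C n) \<noteq> {}"
  proof (rule ccontr)
    assume "\<not> ?thesis"
    then have e: "interior (C n) = {}" for n by blast
    have "euclidean interior_of \<Union>(range C) = {}"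
      by (rule Baire_category_alt) (use clC e completely_metrizable_space_euclidean in auto)
    then show False using cover by simp
  qed
  then obtain n x0 r where r: "r > 0" and sub: "cball x0 r \<subseteq> C n"
    by (meson equals0I mem_interior_cball)
  have "norm (S t) \<le> 2 * real n / r" if t: "t \<in> {0..1 / real (Suc n)}" for t
  proof (rule norm_blinfun_bound)
    show "0 \<le> 2 * real n / r" using r by simp
    fix z :: 'a
    show "norm (S t z) \<le> 2 * real n / r * norm z"
    proof (cases "z = 0")
      case False
      define w where "w = (r / norm z) *\<^sub>R z"
      have nw: "norm w = r" using False r by (simp add: w_def)
      have "x0 + w \<in> C n" "x0 \<in> C n" using sub nw r by (auto simp: dist_norm subset_eq)
      then have "norm (S t (x0 + w)) \<le> n" "norm (S t x0) \<le> n" using t by (auto simp: C_def)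
      then have "norm (S t w) \<le> 2 * real n"
        using norm_triangle_ineq4[of "S t (x0 + w)" "S t x0"] by (simp add: blinfun.add_right)
      then have "r / norm z * norm (S t z) \<le> 2 * real n"
        using r by (simp add: w_def blinfun.scaleR_right)
      then show ?thesis using r False by (simp add: field_simps)
    qed simp
  qed
  moreover have "1 / real (Suc n) > 0" by simp
  ultimately show ?thesis by blast
qed

lemma C0_semigroup_bounded:
  fixes S :: "real \<Rightarrow> 'a::banach \<Rightarrow>\<^sub>L 'a"
  assumes C0: "C0_semigroup S"
  shows "\<exists>M\<ge>1. \<forall>t\<in>{0..T}. norm (S t) \<le> M"
proof -
  from C0_semigroup_bounded_near_zero[OF C0] obtain \<delta> M
    where \<delta>: "\<delta> > 0" and M: "\<And>t. t \<in> {0..\<delta>} \<Longrightarrow> norm (S t) \<le> M" by blast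
  define M' where "M' = max 1 M"
  have M': "M' \<ge> 1" "\<And>t. t \<in> {0..\<delta>} \<Longrightarrow> norm (S t) \<le> M'" using M by (force simp: M'_def)+
  have pow: "norm (S t) \<le> M' ^ Suc n" if "t \<in> {0..real (Suc n) * \<delta>}" for t n
    using that
  proof (induction n arbitrary: t)
    case 0 then show ?case using M' by simp
  next
    case (Suc n)
    \<comment> \<open>Peel off a last factor of length at most \<open>\<delta>\<close>.\<close>
    define s where "s = (if t \<le> \<delta> then 0 else t - \<delta>)"
    have s: "s \<in> {0..real (Suc n) * \<delta>}" "t - s \<in> {0..\<delta>}" "s \<ge> 0" "t - s \<ge> 0"
      using Suc.prems \<delta> by (auto simp: s_def algebra_simps add_nonneg_nonneg)
    have "S t = S (t - s) o\<^sub>L S s"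
      using C0 s unfolding C0_semigroup_def by (metis diff_add_cancel)
    then have "norm (S t) \<le> norm (S (t - s)) * norm (S s)" by (simp add: norm_blinfun_compose)
    also have "\<dots> \<le> M' * M' ^ Suc n" using s M' Suc.IH by (intro mult_mono) auto
    finally show ?case by simp
  qed
  obtain n where "T / \<delta> \<le> real n" using real_arch_simple by blast
  then have "T \<le> real (Suc n) * \<delta>" using \<delta> by (simp add: field_simps)
  then have "\<forall>t\<in>{0..T}. norm (S t) \<le> M' ^ Suc n" using pow[of _ n] by auto
  moreover have "M' ^ Suc n \<ge> 1" using M'(1) by (rule one_le_power)
  ultimately show ?thesis by blast
qed

text \<open>Only right continuity at 0 is given. The estimate
  \<open>norm (S t x - S s x) \<le> M * norm (S (t - s) x - x)\<close> for \<open>s \<le> t\<close> transports it to every time and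
  to both sides.\<close>

lemma C0_semigroup_continuous_on:
  fixes S :: "real \<Rightarrow> 'a::banach \<Rightarrow>\<^sub>L 'a"
  assumes C0: "C0_semigroup S"
  shows "continuous_on {0..T} (\<lambda>t. S t x)"
proof -
  from C0_semigroup_bounded[OF C0] obtain M
    where M: "M \<ge> 1" "\<And>t. t \<in> {0..T} \<Longrightarrow> norm (S t) \<le> M" by blast
  have inc: "norm (S t x - S s x) \<le> M * norm (S (t - s) x - x)" if "0 \<le> s" "s \<le> t" "t \<le> T" for s t
  proof -
    have "S t = S s o\<^sub>L S (t - s)"
      using C0 that unfolding C0_semigroup_def by (metis diff_add_cancel add.commute diff_ge_0_iff_ge)
    then have "S t x - S s x = S s (S (t - s) x - x)" by (simp add: blinfun.diff_right)
    also have "norm \<dots> \<le> norm (S s) * norm (S (t - s) x - x)" by (rule norm_blinfun)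
    also have "\<dots> \<le> M * norm (S (t - s) x - x)" using that M by (intro mult_right_mono) auto
    finally show ?thesis .
  qed
  show ?thesis
    unfolding continuous_on_iff
  proof (intro ballI allI impI)
    fix t e :: real assume t: "t \<in> {0..T}" and e: "e > 0"
    have "((\<lambda>t. S t x) \<longlongrightarrow> x) (at_right 0)" using C0 by (simp add: C0_semigroup_def)
    then have "\<forall>\<^sub>F h in at_right 0. dist (S h x) x < e / M"
      by (rule tendstoD) (use e M in simp)
    then obtain d where d: "d > 0" "\<And>h. 0 < h \<Longrightarrow> h < d \<Longrightarrow> norm (S h x - x) < e / M"
      by (auto simp: eventually_at_right_field dist_norm)
    have *: "norm (S b x - S a x) < e" if "0 \<le> a" "a < b" "b \<le> T" "b - a < d" for a b
    proof -
      have "norm (S b x - S a x) \<le> M * norm (S (b - a) x - x)" using inc that by simp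
      also have "\<dots> < M * (e / M)" using d(2)[of "b - a"] that M by (intro mult_strict_left_mono) auto
      finally show ?thesis using M by simp
    qed
    show "\<exists>d>0. \<forall>x'\<in>{0..T}. dist x' t < d \<longrightarrow> dist (S x' x) (S t x) < e"
    proof (intro exI[of _ d] conjI ballI impI d(1))
      fix s assume s: "s \<in> {0..T}" "dist s t < d"
      consider "s < t" | "s = t" | "t < s" by linarith
      then show "dist (S s x) (S t x) < e"
        using *[of s t] *[of t s] s t e
        by cases (auto simp: dist_norm norm_minus_commute)
    qed
  qed
qed

lemma C0_semigroup_continuous_on_compose:
  fixes S :: "real \<Rightarrow> 'a::banach \<Rightarrow>\<^sub>L 'a"
  assumes C0: "C0_semigroup S" and \<phi>: "continuous_on {0..t} \<phi>"
  shows "continuous_on {0..t} (\<lambda>s. S (t - s) (\<phi> s))"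
proof -
  from C0_semigroup_bounded[OF C0] obtain M
    where M: "M \<ge> 1" "\<And>r. r \<in> {0..t} \<Longrightarrow> norm (S r) \<le> M" by blast
  show ?thesis
    unfolding continuous_on_def
  proof
    fix s assume s: "s \<in> {0..t}"
    have 1: "((\<lambda>r. S (t - r) (\<phi> s)) \<longlongrightarrow> S (t - s) (\<phi> s)) (at s within {0..t})"
    proof -
      have "continuous_on {0..t} (\<lambda>r. S (t - r) (\<phi> s))"
        by (rule continuous_on_compose2[OF C0_semigroup_continuous_on[OF C0, of t]])
           (auto intro!: continuous_on_diff continuous_on_const continuous_on_id)
      then show ?thesis using s by (simp add: continuous_on_def)
    qed
    have 2: "((\<lambda>r. S (t - r) (\<phi> r - \<phi> s)) \<longlongrightarrow> 0) (at s within {0..t})"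
    proof (rule Lim_null_comparison)
      show "\<forall>\<^sub>F r in at s within {0..t}. norm (S (t - r) (\<phi> r - \<phi> s)) \<le> M * norm (\<phi> r - \<phi> s)"
        unfolding eventually_at_filter
      proof (intro always_eventually allI impI)
        fix r assume "r \<in> {0..t}"
        then have "norm (S (t - r)) \<le> M" using M by auto
        then show "norm (S (t - r) (\<phi> r - \<phi> s)) \<le> M * norm (\<phi> r - \<phi> s)"
          using norm_blinfun[of "S (t - r)" "\<phi> r - \<phi> s"] 
          by (meson mult_right_mono norm_ge_zero order_trans)
      qed
      have "(\<phi> \<longlongrightarrow> \<phi> s) (at s within {0..t})" using \<phi> s by (simp add: continuous_on_def)
      then have "((\<lambda>r. M * norm (\<phi> r - \<phi> s)) \<longlongrightarrow> M * norm (\<phi> s - \<phi> s)) (at s within {0..t})"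
        by (intro tendsto_intros)
      then show "((\<lambda>r. M * norm (\<phi> r - \<phi> s)) \<longlongrightarrow> 0) (at s within {0..t})" by simp
    qed
    from tendsto_add[OF 1 2]
    show "((\<lambda>r. S (t - r) (\<phi> r)) \<longlongrightarrow> S (t - s) (\<phi> s)) (at s within {0..t})"
      by (simp add: blinfun.diff_right)
  qed
qed

section \<open>Approximating integrals by combinations of finitely many vectors\<close>

text \<open>If the values of \<open>g\<close> are close to a finite set \<open>F\<close>, the integral of \<open>u\<close> times \<open>g\<close> is close to a
  linear combination of \<open>F\<close> with coefficients bounded by the \<open>L1\<close> norm of \<open>u\<close>. This replaces the
  compactness of closed convex hulls. The weights \<open>\<theta> c\<close> are those of the Schauder projection: they
  form a measurable partition of unity, and \<open>\<theta> c s\<close> is nonzero only if \<open>c\<close> is within \<open>\<rho> s\<close>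
  of \<open>g s\<close>. The radius \<open>\<rho>\<close> may vary with \<open>s\<close>; the main argument uses a small radius at early times
  and a large one at late times.\<close>

lemma ex_bounded_combination_integral_near:
  fixes g :: "'a \<Rightarrow> 'b::real_normed_vector" and u \<rho> :: "'a \<Rightarrow> real"
  assumes u: "integrable M u" and y: "approx_integral M (\<lambda>s. u s *\<^sub>R g s) y"
    and F: "finite F"
    and g[measurable]: "\<And>c. (\<lambda>s. norm (g s - c)) \<in> borel_measurable M"
    and \<rho>[measurable]: "\<rho> \<in> borel_measurable M"
    and u\<rho>: "integrable M (\<lambda>s. \<bar>u s\<bar> * \<rho> s)"
    and near: "\<And>s. s \<in> space M \<Longrightarrow> \<exists>c\<in>F. norm (g s - c) < \<rho> s"
  shows "\<exists>l. (\<forall>c\<in>F. \<bar>l c\<bar> \<le> (\<integral>s. \<bar>u s\<bar> \<partial>M)) \<and>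
             norm (y - (\<Sum>c\<in>F. l c *\<^sub>R c)) \<le> (\<integral>s. \<bar>u s\<bar> * \<rho> s \<partial>M)"
proof -
  have [measurable]: "u \<in> borel_measurable M" using u by auto
  define w where "w c s = max 0 (\<rho> s - norm (g s - c))" for c s
  define W where "W s = (\<Sum>c\<in>F. w c s)" for s
  define \<theta> where "\<theta> c s = w c s / W s" for c s
  have [measurable]: "\<theta> c \<in> borel_measurable M" for c
    unfolding \<theta>_def W_def w_def by measurable
  have w0: "w c s \<ge> 0" for c s by (simp add: w_def)
  have Wpos: "W s > 0" if s: "s \<in> space M" for s
  proof -
    obtain c where c: "c \<in> F" "norm (g s - c) < \<rho> s" using near[OF s] by blast
    have "0 < w c s" using c by (simp add: w_def)
    also have "\<dots> \<le> W s" unfolding W_def using F c w0 by (intro member_le_sum) auto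
    finally show ?thesis .
  qed
  have \<theta>: "\<theta> c s \<ge> 0" "c \<in> F \<Longrightarrow> \<theta> c s \<le> 1" for c s
  proof -
    have W0: "W s \<ge> 0" unfolding W_def by (intro sum_nonneg w0)
    show "\<theta> c s \<ge> 0" using w0 W0 by (simp add: \<theta>_def)
    show "\<theta> c s \<le> 1" if "c \<in> F"
      using member_le_sum[of c F "\<lambda>c. w c s"] that F w0 W0
      by (auto simp: \<theta>_def W_def divide_le_eq_1)
  qed
  have \<theta>1: "(\<Sum>c\<in>F. \<theta> c s) = 1" if "s \<in> space M" for s
    using Wpos[OF that] by (simp add: \<theta>_def W_def flip: sum_divide_distrib)
  have u\<theta>: "integrable M (\<lambda>s. u s * \<theta> c s)" if "c \<in> F" for c
  proof (rule Bochner_Integration.integrable_bound[OF u])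
    show "AE s in M. norm (u s * \<theta> c s) \<le> norm (u s)"
      using \<theta>[of c] that by (intro AE_I2) (simp add: abs_mult mult_left_le)
  qed measurable
  define l where "l c = (\<integral>s. u s * \<theta> c s \<partial>M)" for c
  have "\<bar>l c\<bar> \<le> (\<integral>s. \<bar>u s\<bar> \<partial>M)" if "c \<in> F" for c
  proof -
    have "\<bar>l c\<bar> \<le> (\<integral>s. \<bar>u s * \<theta> c s\<bar> \<partial>M)"
      unfolding l_def by (rule integral_abs_bound)
    also have "\<dots> \<le> (\<integral>s. \<bar>u s\<bar> \<partial>M)"
      using \<theta>[of c] that
      by (intro integral_mono integrable_abs u\<theta> u) (auto simp: abs_mult mult_left_le)
    finally show ?thesis .
  qed
  moreover have "norm (y - (\<Sum>c\<in>F. l c *\<^sub>R c)) \<le> (\<integral>s. \<bar>u s\<bar> * \<rho> s \<partial>M)"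
  proof (rule approx_integral_norm_diff_le_integral[OF y _ u\<rho>])
    show "approx_integral M (\<lambda>s. \<Sum>c\<in>F. (u s * \<theta> c s) *\<^sub>R c) (\<Sum>c\<in>F. l c *\<^sub>R c)"
      unfolding l_def by (intro approx_integral_sum approx_integral_scaleR_left u\<theta>)
    fix s assume s: "s \<in> space M"
    have "g s = (\<Sum>c\<in>F. \<theta> c s) *\<^sub>R g s" using \<theta>1[OF s] by simp
    then have "g s - (\<Sum>c\<in>F. \<theta> c s *\<^sub>R c) = (\<Sum>c\<in>F. \<theta> c s *\<^sub>R (g s - c))"
      by (simp add: scaleR_sum_left scaleR_diff_right sum_subtractf)
    also have "norm \<dots> \<le> (\<Sum>c\<in>F. \<theta> c s * \<rho> s)"
    proof (rule sum_norm_le)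
      fix c assume "c \<in> F"
      show "norm (\<theta> c s *\<^sub>R (g s - c)) \<le> \<theta> c s * \<rho> s"
      proof (cases "w c s = 0")
        case False
        then have "norm (g s - c) \<le> \<rho> s" by (auto simp: w_def max_def split: if_splits)
        then show ?thesis using \<theta>[of c s] by (simp add: mult_left_mono)
      qed (simp add: \<theta>_def)
    qed
    also have "\<dots> = \<rho> s" using \<theta>1[OF s] by (simp flip: sum_distrib_right)
    finally have *: "norm (g s - (\<Sum>c\<in>F. \<theta> c s *\<^sub>R c)) \<le> \<rho> s" .
    have "u s *\<^sub>R g s - (\<Sum>c\<in>F. (u s * \<theta> c s) *\<^sub>R c) = u s *\<^sub>R (g s - (\<Sum>c\<in>F. \<theta> c s *\<^sub>R c))"
      by (simp add: scaleR_sum_right scaleR_diff_right)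
    then show "norm (u s *\<^sub>R g s - (\<Sum>c\<in>F. (u s * \<theta> c s) *\<^sub>R c)) \<le> \<bar>u s\<bar> * \<rho> s"
      using * by (simp add: mult_left_mono)
  qed
  ultimately show ?thesis by blast
qed

text \<open>A linear image of a cube, hence compact; the induction adds one coordinate at a time.\<close>

lemma compact_bounded_combinations:
  fixes F :: "'b::real_normed_vector set"
  assumes "finite F"
  shows "compact {\<Sum>c\<in>F. l c *\<^sub>R c | l. \<forall>c\<in>F. \<bar>l c\<bar> \<le> L}"
  using assms
proof (induction F)
  case empty
  then show ?case by simp
next
  case (insert a F)
  let ?Z = "{\<Sum>c\<in>F. l c *\<^sub>R c | l. \<forall>c\<in>F. \<bar>l c\<bar> \<le> L}"
  have "{\<Sum>c\<in>insert a F. l c *\<^sub>R c | l. \<forall>c\<in>insert a F. \<bar>l c\<bar> \<le> L}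
      = {x + y | x y. x \<in> (\<lambda>r. r *\<^sub>R a) ` {-L..L} \<and> y \<in> ?Z}" (is "?A = ?B")
  proof
    show "?A \<subseteq> ?B" using insert.hyps by (auto simp: abs_le_iff)  (force simp: abs_le_iff)
    show "?B \<subseteq> ?A"
    proof safe
      fix r l assume r: "r \<in> {-L..L}" and l: "\<forall>c\<in>F. \<bar>l c\<bar> \<le> L"
      have "(\<Sum>c\<in>F. l c *\<^sub>R c) = (\<Sum>c\<in>F. (l(a := r)) c *\<^sub>R c)"
        using insert.hyps by (intro sum.cong) auto
      then show "\<exists>l'. r *\<^sub>R a + (\<Sum>c\<in>F. l c *\<^sub>R c) = (\<Sum>c\<in>insert a F. l' c *\<^sub>R c) \<and>
          (\<forall>c\<in>insert a F. \<bar>l' c\<bar> \<le> L)"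
        using insert.hyps r l by (intro exI[of _ "l(a := r)"]) auto
    qed
  qed
  moreover have "compact ?B"
    by (intro compact_sums insert.IH compact_continuous_image continuous_intros compact_Icc)
  ultimately show ?case by simp
qed

section \<open>Control mass and a Gronwall inequality\<close>

definition control_mass :: "(real \<Rightarrow> real) \<Rightarrow> real \<Rightarrow> real" where
  "control_mass u t = integral {0..t} (\<lambda>s. \<bar>u s\<bar>)"

lemma L1_loc_integrable:
  assumes "u \<in> L1_loc"
  shows "integrable (lebesgue_on {0..t}) u"
proof (cases "t \<ge> 0")
  case True
  then have "set_integrable lebesgue {0..t} u" using assms by (simp add: L1_loc_def)
  then show ?thesis by (simp add: set_integrable_def integrable_restrict_space)
next
  case False
  then have "integrable (lebesgue_on {}) u"
    by (simp add: integrable_restrict_space)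
  with False show ?thesis by simp
qed

lemma L1_loc_abs_integrable_on:
  assumes "u \<in> L1_loc"
  shows "(\<lambda>s. \<bar>u s\<bar>) integrable_on {0..t}"
  by (intro integrable_on_lebesgue_on integrable_abs L1_loc_integrable assms) simp

lemma control_mass_eq:
  assumes "u \<in> L1_loc"
  shows "(\<integral>s. \<bar>u s\<bar> \<partial>lebesgue_on {0..t}) = control_mass u t"
  unfolding control_mass_def
  by (intro lebesgue_integral_eq_integral integrable_abs L1_loc_integrable assms) simp

lemma control_mass_zero [simp]: "control_mass u 0 = 0"
  by (simp add: control_mass_def)

lemma control_mass_mono:
  assumes "u \<in> L1_loc" "s \<le> t"
  shows "control_mass u s \<le> control_mass u t"
  unfolding control_mass_def
  using assms by (intro integral_subset_le L1_loc_abs_integrable_on) auto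

lemma control_mass_nonneg: "u \<in> L1_loc \<Longrightarrow> 0 \<le> control_mass u t"
  unfolding control_mass_def by (intro integral_nonneg L1_loc_abs_integrable_on) auto

text \<open>Both the Gronwall inequality and the covering argument estimate an integrand well before a time
  \<open>s0\<close> and only crudely after it; this evaluates the resulting two-step bound.\<close>

lemma integral_step_weight:
  assumes u: "u \<in> L1_loc" and s0: "0 \<le> s0" "s0 \<le> t"
  shows "integrable (lebesgue_on {0..t}) (\<lambda>s. \<bar>u s\<bar> * (if s < s0 then p else q))"
    and "(\<integral>s. \<bar>u s\<bar> * (if s < s0 then p else q) \<partial>lebesgue_on {0..t})
           = p * control_mass u s0 + q * (control_mass u t - control_mass u s0)"
proof -
  let ?f = "\<lambda>s. \<bar>u s\<bar> * (if s < s0 then p else q)"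
  have [measurable]: "u \<in> borel_measurable (lebesgue_on {0..t})"
    using L1_loc_integrable[OF u] by auto
  have [measurable]: "(\<lambda>s. s) \<in> borel_measurable (lebesgue_on {0..t})"
    using id_borel_measurable_lebesgue_on[of "{0..t}"] by (simp add: id_def)
  show int: "integrable (lebesgue_on {0..t}) ?f"
  proof (rule Bochner_Integration.integrable_bound)
    show "integrable (lebesgue_on {0..t}) (\<lambda>s. (\<bar>p\<bar> + \<bar>q\<bar>) * u s)"
      by (intro integrable_mult_right L1_loc_integrable u)
    show "AE s in lebesgue_on {0..t}. norm (?f s) \<le> norm ((\<bar>p\<bar> + \<bar>q\<bar>) * u s)"
      by (intro AE_I2) (auto simp: abs_mult mult.commute[of "\<bar>u _\<bar>"] intro!: mult_right_mono)
  qed measurable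
  have I: "((\<lambda>s. \<bar>u s\<bar>) has_integral control_mass u r) {0..r}" for r
    unfolding control_mass_def by (intro integrable_integral L1_loc_abs_integrable_on u)
  have "((\<lambda>s. \<bar>u s\<bar>) has_integral (control_mass u t - control_mass u s0)) {s0..t}"
  proof -
    have "(\<lambda>s. \<bar>u s\<bar>) integrable_on {s0..t}"
      by (rule integrable_on_subinterval[OF L1_loc_abs_integrable_on[OF u, of t]]) (use s0 in auto)
    moreover have "integral {s0..t} (\<lambda>s. \<bar>u s\<bar>) = control_mass u t - control_mass u s0"
      using Henstock_Kurzweil_Integration.integral_combine[OF s0 L1_loc_abs_integrable_on[OF u]]
      by (simp add: control_mass_def)
    ultimately show ?thesis by (metis integrable_integral)
  qed
  from has_integral_mult_right[OF this, of q]
  have 2: "(?f has_integral q * (control_mass u t - control_mass u s0)) {s0..t}"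
    by (rule has_integral_eq[rotated]) auto
  have 1: "(?f has_integral p * control_mass u s0) {0..s0}"
    by (rule has_integral_spike_finite[OF _ _ has_integral_mult_right[OF I[of s0], of p], of "{s0}"]) auto
  have "(?f has_integral p * control_mass u s0 + q * (control_mass u t - control_mass u s0)) {0..t}"
    by (rule has_integral_combine[OF s0 1 2])
  then show "integral\<^sup>L (lebesgue_on {0..t}) ?f
      = p * control_mass u s0 + q * (control_mass u t - control_mass u s0)"
    using lebesgue_integral_eq_integral[OF int] by (simp add: integral_unique)
qed

text \<open>The time \<open>s0\<close> is where the remaining mass is exactly \<open>\<epsilon>\<close>, found by the intermediate value
  theorem. If the total mass is at most \<open>\<epsilon>\<close>, take \<open>s0 = 0\<close>. With strict bounds on the
  mass, an induction on \<open>j\<close> can start at \<open>j = 0\<close>, where no time qualifies.\<close>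

lemma ex_split_control_mass:
  assumes u: "u \<in> L1_loc" and \<epsilon>: "\<epsilon> > 0" and t: "0 \<le> t"
    and Ut: "control_mass u t < real (Suc j) * \<epsilon>"
  shows "\<exists>s0\<in>{0..t}. (\<forall>s\<in>{0..<s0}. control_mass u s < real j * \<epsilon>) \<and>
           control_mass u s0 \<le> real j * \<epsilon> \<and> control_mass u t - control_mass u s0 \<le> \<epsilon>"
proof (cases "control_mass u t \<le> \<epsilon>")
  case True
  with t \<epsilon> show ?thesis by (intro bexI[of _ 0]) auto
next
  case False
  have "continuous_on {0..t} (control_mass u)"
    unfolding control_mass_def[abs_def]
    by (intro indefinite_integral_continuous_1 L1_loc_abs_integrable_on u)
  then obtain s0 where s0: "0 \<le> s0" "s0 \<le> t" "control_mass u s0 = control_mass u t - \<epsilon>"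
    using IVT'[of "control_mass u" 0 "control_mass u t - \<epsilon>" t] False t \<epsilon> by auto
  have "control_mass u s < real j * \<epsilon>" if "s \<in> {0..<s0}" for s
    using control_mass_mono[OF u, of s s0] that s0 Ut by (simp add: algebra_simps)
  with s0 Ut show ?thesis by (intro bexI[of _ s0]) (auto simp: algebra_simps)
qed

lemma integrable_L1_loc_mult_continuous:
  assumes u: "u \<in> L1_loc" and d: "continuous_on {0..t} d"
  shows "integrable (lebesgue_on {0..t}) (\<lambda>s. \<bar>u s\<bar> * d s)"
proof -
  have [measurable]: "u \<in> borel_measurable (lebesgue_on {0..t})"
    "d \<in> borel_measurable (lebesgue_on {0..t})"
    using L1_loc_integrable[OF u] d by (auto intro: continuous_imp_measurable_on_sets_lebesgue)
  obtain C where C: "\<And>s. s \<in> {0..t} \<Longrightarrow> norm (d s) \<le> C"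
    using compact_imp_bounded[OF compact_continuous_image[OF d compact_Icc]]
    unfolding bounded_iff by blast
  show ?thesis
  proof (rule Bochner_Integration.integrable_bound)
    show "integrable (lebesgue_on {0..t}) (\<lambda>s. C * u s)"
      by (intro integrable_mult_right L1_loc_integrable u)
    show "AE s in lebesgue_on {0..t}. norm (\<bar>u s\<bar> * d s) \<le> norm (C * u s)"
    proof (rule AE_I2)
      fix s assume "s \<in> space (lebesgue_on {0..t})"
      then have "\<bar>d s\<bar> \<le> \<bar>C\<bar>" using C[of s] by simp
      then show "norm (\<bar>u s\<bar> * d s) \<le> norm (C * u s)"
        by (simp add: abs_mult mult.commute[of "\<bar>u s\<bar>"] mult_right_mono)
    qed
  qed measurable
qed

text \<open>The bound $c_{j+1} = 2 + j\,c_j$ solves the recursion that one step of length \<open>\<epsilon>\<close> produces in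
  the lemma below. It depends on the number of steps alone, hence is uniform in the control and
  in the solution.\<close>

primrec gronwall_const :: "nat \<Rightarrow> real" where
  "gronwall_const 0 = 0"
| "gronwall_const (Suc j) = 2 + real j * gronwall_const j"

lemma gronwall_const_nonneg: "0 \<le> gronwall_const j"
  by (induction j) auto

text \<open>A discrete Gronwall inequality with respect to the measure \<open>\<bar>u s\<bar> ds\<close>. On the set of times with
  mass below \<open>(j + 1) \<epsilon>\<close>, the part of the integral carried by earlier steps is controlled by the
  induction hypothesis, and the remaining part is at most half the supremum \<open>\<sigma>\<close> of \<open>d\<close> over that set,
  so it can be absorbed on the left. Continuity of \<open>d\<close> matters because it makes \<open>\<sigma>\<close> finite.\<close>

lemma gronwall_control_mass:
  fixes k \<epsilon> :: real
  assumes k: "k \<ge> 0" and \<epsilon>: "\<epsilon> > 0" and k\<epsilon>: "k * \<epsilon> \<le> 1 / 2"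
    and u: "u \<in> L1_loc" and a: "a \<ge> 0" and d: "continuous_on {0..T} d"
    and d0: "\<And>t. t \<in> {0..T} \<Longrightarrow> 0 \<le> d t"
    and ineq: "\<And>t. t \<in> {0..T} \<Longrightarrow> d t \<le> a + k * (\<integral>s. \<bar>u s\<bar> * d s \<partial>lebesgue_on {0..t})"
    and t: "t \<in> {0..T}" "control_mass u t < real j * \<epsilon>"
  shows "d t \<le> gronwall_const j * a"
  using t
proof (induction j arbitrary: t)
  case 0
  then show ?case using control_mass_nonneg[OF u, of t] by simp
next
  case (Suc j t')
  note t' = Suc.prems
  define c where "c = gronwall_const j"
  have c: "c \<ge> 0" by (simp add: c_def gronwall_const_nonneg)
  let ?P = "{t\<in>{0..T}. control_mass u t < real (Suc j) * \<epsilon>}"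
  define \<sigma> where "\<sigma> = Sup (d ` ?P)"
  have "bdd_above (d ` {0..T})"
    by (intro bounded_imp_bdd_above compact_imp_bounded compact_continuous_image d compact_Icc)
  then have bdd: "bdd_above (d ` ?P)" by (rule bdd_above_mono) auto
  have le\<sigma>: "d s \<le> \<sigma>" if "s \<in> ?P" for s
    unfolding \<sigma>_def using that bdd by (intro cSup_upper) auto
  have \<sigma>0: "\<sigma> \<ge> 0" using le\<sigma>[of t'] d0[OF t'(1)] t' by simp
  have "\<sigma> \<le> a + real j * c * a / 2 + \<sigma> / 2"
    unfolding \<sigma>_def
  proof (rule cSup_least)
    show "d ` ?P \<noteq> {}" using t' by auto
    fix z assume "z \<in> d ` ?P"
    then obtain t where z: "z = d t" and t: "t \<in> {0..T}" "control_mass u t < real (Suc j) * \<epsilon>" by auto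
    obtain s0 where s0: "0 \<le> s0" "s0 \<le> t" "\<And>s. 0 \<le> s \<Longrightarrow> s < s0 \<Longrightarrow> control_mass u s < real j * \<epsilon>"
      "control_mass u s0 \<le> real j * \<epsilon>" "control_mass u t - control_mass u s0 \<le> \<epsilon>"
      using ex_split_control_mass[OF u \<epsilon> _ t(2)] t(1) by auto
    have "(\<integral>s. \<bar>u s\<bar> * d s \<partial>lebesgue_on {0..t})
        \<le> (\<integral>s. \<bar>u s\<bar> * (if s < s0 then c * a else \<sigma>) \<partial>lebesgue_on {0..t})"
    proof (rule integral_mono)
      show "integrable (lebesgue_on {0..t}) (\<lambda>s. \<bar>u s\<bar> * d s)"
        using t by (intro integrable_L1_loc_mult_continuous u continuous_on_subset[OF d]) auto
      show "integrable (lebesgue_on {0..t}) (\<lambda>s. \<bar>u s\<bar> * (if s < s0 then c * a else \<sigma>))"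
        using integral_step_weight(1)[OF u s0(1,2)] .
      fix s assume "s \<in> space (lebesgue_on {0..t})"
      then have s: "0 \<le> s" "s \<le> t" "s \<le> T" using t by auto
      have "d s \<le> (if s < s0 then c * a else \<sigma>)"
        using Suc.IH[of s] le\<sigma>[of s] s s0(3)[of s] control_mass_mono[OF u s(2)] t
        by (auto simp: c_def)
      then show "\<bar>u s\<bar> * d s \<le> \<bar>u s\<bar> * (if s < s0 then c * a else \<sigma>)"
        by (rule mult_left_mono) simp
    qed
    also have "\<dots> = c * a * control_mass u s0 + \<sigma> * (control_mass u t - control_mass u s0)"
      using integral_step_weight(2)[OF u s0(1,2)] .
    also have "\<dots> \<le> c * a * (real j * \<epsilon>) + \<sigma> * \<epsilon>"
      using s0 c a \<sigma>0 by (intro add_mono mult_left_mono) auto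
    finally have "k * (\<integral>s. \<bar>u s\<bar> * d s \<partial>lebesgue_on {0..t}) \<le> k * (c * a * (real j * \<epsilon>) + \<sigma> * \<epsilon>)"
      using k by (rule mult_left_mono)
    also have "\<dots> = (k * \<epsilon>) * (real j * c * a + \<sigma>)" by (simp add: algebra_simps)
    also have "\<dots> \<le> (1 / 2) * (real j * c * a + \<sigma>)"
      using k\<epsilon> \<sigma>0 c a by (intro mult_right_mono) auto
    finally show "z \<le> a + real j * c * a / 2 + Sup (d ` ?P) / 2"
      using ineq[OF t(1)] by (simp add: z \<sigma>_def add_divide_distrib)
  qed
  then have "\<sigma> \<le> gronwall_const (Suc j) * a" by (simp add: c_def algebra_simps)
  then show ?case using le\<sigma>[of t'] t' by auto
qed

section \<open>Mild solutions\<close>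

lemma mild_solution_on_approx_integral:
  assumes "mild_solution_on {0..} S B u \<psi>0 \<psi>" "0 \<le> t"
  obtains y where "approx_integral (lebesgue_on {0..t}) (\<lambda>s. u s *\<^sub>R S (t - s) (B (\<psi> s))) y"
    and "\<psi> t = S t \<psi>0 + y"
  using assms approx_integral_has_bochner_integral_gen unfolding mild_solution_on_def by fastforce

lemma mild_solution_on_continuous:
  assumes "mild_solution_on {0..} S B u \<psi>0 \<psi>"
  shows "continuous_on {0..t} \<psi>"
  using assms by (auto simp: mild_solution_on_def intro: continuous_on_subset)

lemma norm_blinfun_apply2_le:
  fixes S B :: "'a::real_normed_vector \<Rightarrow>\<^sub>L 'a"
  assumes "norm S \<le> M"
  shows "norm (S (B x)) \<le> M * norm B * norm x"
proof -
  have "norm (S (B x)) \<le> norm S * (norm B * norm x)"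
    by (rule order_trans[OF norm_blinfun mult_left_mono[OF norm_blinfun]]) simp
  also have "\<dots> \<le> M * (norm B * norm x)" using assms by (intro mult_right_mono) auto
  finally show ?thesis by (simp add: mult.assoc)
qed

text \<open>The step length is chosen so that control of mass \<open>\<epsilon>\<close> makes the integral operator of the mild
  equation a contraction with factor one half.\<close>

lemma obtain_step_length:
  fixes S :: "real \<Rightarrow> 'a::banach \<Rightarrow>\<^sub>L 'a"
  assumes C0: "C0_semigroup S"
  obtains M \<epsilon> where "M \<ge> 0" "\<And>r. r \<in> {0..T} \<Longrightarrow> norm (S r) \<le> M"
    and "\<epsilon> > 0" "M * norm B * \<epsilon> \<le> 1 / 2"
proof -
  from C0_semigroup_bounded[OF C0] obtain M
    where M: "M \<ge> 1" "\<And>r. r \<in> {0..T} \<Longrightarrow> norm (S r) \<le> M" by blast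
  define k where "k = M * norm B"
  have k: "k \<ge> 0" using M by (simp add: k_def)
  have "1 / (2 * (k + 1)) > 0" "k * (1 / (2 * (k + 1))) \<le> 1 / 2"
    using k by (auto simp: field_simps)
  then show thesis using M by (intro that[of M "1 / (2 * (k + 1))"]) (auto simp: k_def)
qed

text \<open>Lipschitz dependence on the initial value, with the control fixed: the difference of two mild
  solutions satisfies the hypothesis of the Gronwall inequality. Equal initial values give uniqueness;
  comparison with the zero solution gives an a priori bound.\<close>

lemma mild_solution_on_Lipschitz:
  fixes S :: "real \<Rightarrow> 'a::banach \<Rightarrow>\<^sub>L 'a"
  assumes M: "M \<ge> 0" "\<And>r. r \<in> {0..T} \<Longrightarrow> norm (S r) \<le> M"
    and \<epsilon>: "\<epsilon> > 0" "M * norm B * \<epsilon> \<le> 1 / 2"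
    and u: "u \<in> L1_loc"
    and \<psi>: "mild_solution_on {0..} S B u \<psi>0 \<psi>" and \<phi>: "mild_solution_on {0..} S B u \<phi>0 \<phi>"
    and t: "t \<in> {0..T}" "control_mass u t < real j * \<epsilon>"
  shows "norm (\<psi> t - \<phi> t) \<le> gronwall_const j * (M * norm (\<psi>0 - \<phi>0))"
proof -
  define k where "k = M * norm B"
  have k: "k \<ge> 0" and k\<epsilon>: "k * \<epsilon> \<le> 1 / 2" using M \<epsilon> by (simp_all add: k_def)
  define d where "d t = norm (\<psi> t - \<phi> t)" for t
  have dc: "continuous_on {0..T} d"
    unfolding d_def
    by (intro continuous_intros mild_solution_on_continuous[OF \<psi>] mild_solution_on_continuous[OF \<phi>])
  have "d t \<le> M * norm (\<psi>0 - \<phi>0) + k * (\<integral>s. \<bar>u s\<bar> * d s \<partial>lebesgue_on {0..t})" if t: "t \<in> {0..T}" for t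
  proof -
    from t have t0: "0 \<le> t" by simp
    obtain y where y: "approx_integral (lebesgue_on {0..t}) (\<lambda>s. u s *\<^sub>R S (t - s) (B (\<psi> s))) y"
      "\<psi> t = S t \<psi>0 + y" by (rule mild_solution_on_approx_integral[OF \<psi> t0])
    obtain z where z: "approx_integral (lebesgue_on {0..t}) (\<lambda>s. u s *\<^sub>R S (t - s) (B (\<phi> s))) z"
      "\<phi> t = S t \<phi>0 + z" by (rule mild_solution_on_approx_integral[OF \<phi> t0])
    have "norm (y - z) \<le> (\<integral>s. k * (\<bar>u s\<bar> * d s) \<partial>lebesgue_on {0..t})"
    proof (rule approx_integral_norm_diff_le_integral[OF y(1) z(1)])
      show "integrable (lebesgue_on {0..t}) (\<lambda>s. k * (\<bar>u s\<bar> * d s))"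
        using t by (intro integrable_mult_right integrable_L1_loc_mult_continuous u
            continuous_on_subset[OF dc]) auto
      fix s assume "s \<in> space (lebesgue_on {0..t})"
      then have "norm (S (t - s)) \<le> M" using t by (intro M) auto
      from norm_blinfun_apply2_le[OF this, of B "\<psi> s - \<phi> s"]
      have "norm (S (t - s) (B (\<psi> s)) - S (t - s) (B (\<phi> s))) \<le> k * d s"
        by (simp add: k_def d_def blinfun.diff_right)
      from mult_left_mono[OF this, of "\<bar>u s\<bar>"]
      show "norm (u s *\<^sub>R S (t - s) (B (\<psi> s)) - u s *\<^sub>R S (t - s) (B (\<phi> s))) \<le> k * (\<bar>u s\<bar> * d s)"
        by (simp add: mult.left_commute flip: scaleR_diff_right)
    qed
    moreover have "norm (S t (\<psi>0 - \<phi>0)) \<le> M * norm (\<psi>0 - \<phi>0)"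
      using M(2)[OF t] norm_blinfun[of "S t" "\<psi>0 - \<phi>0"] by (meson mult_right_mono norm_ge_zero order_trans)
    moreover have "\<psi> t - \<phi> t = S t (\<psi>0 - \<phi>0) + (y - z)" by (simp add: y z blinfun.diff_right)
    ultimately show ?thesis
      using norm_triangle_ineq[of "S t (\<psi>0 - \<phi>0)" "y - z"] by (simp add: d_def)
  qed
  then have "d t \<le> gronwall_const j * (M * norm (\<psi>0 - \<phi>0))"
    using M by (intro gronwall_control_mass[OF k \<epsilon>(1) k\<epsilon> u _ dc _ _ t]) (auto simp: d_def)
  then show ?thesis by (simp add: d_def)
qed

lemma mild_solution_on_unique:
  fixes S :: "real \<Rightarrow> 'a::banach \<Rightarrow>\<^sub>L 'a"
  assumes C0: "C0_semigroup S" and u: "u \<in> L1_loc"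
    and \<psi>: "mild_solution_on {0..} S B u \<psi>0 \<psi>" and \<phi>: "mild_solution_on {0..} S B u \<psi>0 \<phi>"
    and T: "0 \<le> T"
  shows "\<psi> T = \<phi> T"
proof -
  obtain M \<epsilon> where M: "M \<ge> 0" "\<And>r. r \<in> {0..T} \<Longrightarrow> norm (S r) \<le> M"
    and \<epsilon>: "\<epsilon> > 0" "M * norm B * \<epsilon> \<le> 1 / 2"
    using obtain_step_length[OF C0, where T = T and B = B] by blast
  obtain j where "control_mass u T / \<epsilon> < real j" using reals_Archimedean2 by blast
  then have "control_mass u T < real j * \<epsilon>" using \<epsilon> by (simp add: field_simps)
  from mild_solution_on_Lipschitz[where S = S and T = T, OF M \<epsilon> u \<psi> \<phi> _ this] T show ?thesis by simp
qed

lemma mild_solution_on_zero: "mild_solution_on I S B u 0 (\<lambda>_. 0)"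
proof -
  have "has_bochner_integral_gen (lebesgue_on {0..t}) (\<lambda>s. 0) (0::'a)" for t :: real
    unfolding has_bochner_integral_gen_def
    by (intro conjI exI[of _ "\<lambda>i x. 0"] allI)
       (auto simp: simple_bochner_integrable.simps
          Bochner_Integration.simple_bochner_integral_def image_constant_conv)
  then show ?thesis unfolding mild_solution_on_def by (auto simp: blinfun.zero_right)
qed

section \<open>Total boundedness of reachable sets\<close>

text \<open>Measuring a control by the mass it has spent before the time of observation, and not by its mass
  on all of \<open>{0..T}\<close>, makes these sets compatible with restriction to earlier times on the
  same trajectory.\<close>

definition reachable ::
    "(real \<Rightarrow> 'a::real_normed_vector \<Rightarrow>\<^sub>L 'a) \<Rightarrow> ('a \<Rightarrow>\<^sub>L 'a) \<Rightarrow> 'a \<Rightarrow> real \<Rightarrow> real \<Rightarrow> 'a set" where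
  "reachable S B \<psi>0 T m = {\<psi> t | \<psi> u t. u \<in> L1_loc \<and> mild_solution_on {0..} S B u \<psi>0 \<psi> \<and>
     t \<in> {0..T} \<and> control_mass u t < m}"

lemma reachableI:
  "u \<in> L1_loc \<Longrightarrow> mild_solution_on {0..} S B u \<psi>0 \<psi> \<Longrightarrow> t \<in> {0..T} \<Longrightarrow> control_mass u t < m \<Longrightarrow>
    \<psi> t \<in> reachable S B \<psi>0 T m"
  unfolding reachable_def by blast

lemma reachable_mono: "m \<le> n \<Longrightarrow> reachable S B \<psi>0 T m \<subseteq> reachable S B \<psi>0 T n"
  unfolding reachable_def using less_le_trans[of _ m n] by blast

lemma reachable_bounded:
  fixes S :: "real \<Rightarrow> 'a::banach \<Rightarrow>\<^sub>L 'a"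
  assumes M: "M \<ge> 0" "\<And>r. r \<in> {0..T} \<Longrightarrow> norm (S r) \<le> M"
    and \<epsilon>: "\<epsilon> > 0" "M * norm B * \<epsilon> \<le> 1 / 2"
  shows "\<exists>C. \<forall>x\<in>reachable S B \<psi>0 T (real j * \<epsilon>). norm x \<le> C"
proof (intro exI ballI)
  fix x assume "x \<in> reachable S B \<psi>0 T (real j * \<epsilon>)"
  then obtain \<psi> u t where "x = \<psi> t" "u \<in> L1_loc" "mild_solution_on {0..} S B u \<psi>0 \<psi>"
    "t \<in> {0..T}" "control_mass u t < real j * \<epsilon>"
    by (auto simp: reachable_def)
  then show "norm x \<le> gronwall_const j * (M * norm \<psi>0)"
    using mild_solution_on_Lipschitz[OF M \<epsilon> _ _ mild_solution_on_zero] by fastforce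
qed

text \<open>The heart of the proof: a cover by balls of radius \<open>r\<close> improves to one of radius \<open>3 / 4 * r\<close>.
  Split the Duhamel integral at the time \<open>s0\<close> after which the control has mass at most \<open>\<epsilon>\<close>. Before
  \<open>s0\<close> the trajectory lies in the totally bounded set of the previous step, so its states are within
  \<open>\<delta>\<close> of a finite set \<open>G\<close>. After \<open>s0\<close> it is only within \<open>r\<close> of \<open>F\<close>, but that part
  of the integral contributes an error of at most \<open>k * r * \<epsilon> \<le> r / 2\<close>, where
  \<open>k = M * norm B\<close>. The vectors \<open>S \<tau> (B c)\<close> with \<open>c\<close> in \<open>F \<union> G\<close> form a compact set, so finitely many vectors \<open>N\<close> suffice for the whole
  integrand, and the trajectory ends near a compact set that is independent of the control.\<close>

lemma reachable_refine_cover: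
  fixes S :: "real \<Rightarrow> 'a::banach \<Rightarrow>\<^sub>L 'a"
  assumes C0: "C0_semigroup S"
    and M: "M \<ge> 0" "\<And>r. r \<in> {0..T} \<Longrightarrow> norm (S r) \<le> M"
    and \<epsilon>: "\<epsilon> > 0" "M * norm B * \<epsilon> \<le> 1 / 2"
    and prev: "totally_bounded (reachable S B \<psi>0 T (real j * \<epsilon>))"
    and F: "finite F" "reachable S B \<psi>0 T (real (Suc j) * \<epsilon>) \<subseteq> (\<Union>c\<in>F. ball c r)" and r: "r > 0"
  shows "\<exists>F'. finite F' \<and> reachable S B \<psi>0 T (real (Suc j) * \<epsilon>) \<subseteq> (\<Union>c\<in>F'. ball c (3 / 4 * r))"
proof -
  define k where "k = M * norm B"
  define L where "L = real (Suc j) * \<epsilon>"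
  have k: "k \<ge> 0" and L: "L > 0" and k\<epsilon>: "k * \<epsilon> \<le> 1 / 2" and jL: "real j * \<epsilon> \<le> L"
    using M \<epsilon> by (auto simp: k_def L_def)
  \<comment> \<open>Chosen so that the errors \<open>k * \<delta> * L\<close> and \<open>\<eta> * L\<close> are at most \<open>r / 16\<close> each.\<close>
  define \<delta> where "\<delta> = r / (16 * (k * L + 1))"
  define \<eta> where "\<eta> = r / (16 * L)"
  have \<delta>: "\<delta> > 0" and \<eta>: "\<eta> > 0"
    using r k L by (auto simp: \<delta>_def \<eta>_def intro!: divide_pos_pos add_nonneg_pos)
  have cancel: "x * (r / (16 * x)) = r / 16" if "0 < x" for x using that by simp
  have "0 < k * L + 1" using k L by (simp add: add_nonneg_pos)
  then have "(k * L + 1) * \<delta> = r / 16"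
    unfolding \<delta>_def by (rule cancel)
  then have \<delta>L: "k * \<delta> * L \<le> r / 16" using \<delta> by (simp add: algebra_simps)
  have \<eta>L: "\<eta> * L = r / 16" using L by (simp add: \<eta>_def)
  obtain G where G: "finite G" "reachable S B \<psi>0 T (real j * \<epsilon>) \<subseteq> (\<Union>c\<in>G. {y. dist c y < \<delta>})"
    using prev \<delta> unfolding totally_bounded_metric by blast
  have "compact (\<Union>c\<in>F \<union> G. (\<lambda>\<tau>. S \<tau> (B c)) ` {0..T})"
    using F(1) G(1)
    by (intro compact_UN compact_continuous_image C0_semigroup_continuous_on C0 compact_Icc) auto
  then obtain N where N: "finite N" "(\<Union>c\<in>F \<union> G. (\<lambda>\<tau>. S \<tau> (B c)) ` {0..T}) \<subseteq> (\<Union>c\<in>N. ball c \<eta>)"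
    using \<eta> unfolding compact_eq_totally_bounded by meson
  define Z where "Z = {\<Sum>c\<in>N. l c *\<^sub>R c | l. \<forall>c\<in>N. \<bar>l c\<bar> \<le> L}"
  have "compact {x + z | x z. x \<in> (\<lambda>\<tau>. S \<tau> \<psi>0) ` {0..T} \<and> z \<in> Z}"
    unfolding Z_def
    by (intro compact_sums compact_bounded_combinations N compact_continuous_image
        C0_semigroup_continuous_on C0 compact_Icc)
  moreover have "r / 8 > 0" using r by simp
  ultimately obtain F' where F': "finite F'"
    "{x + z | x z. x \<in> (\<lambda>\<tau>. S \<tau> \<psi>0) ` {0..T} \<and> z \<in> Z} \<subseteq> (\<Union>c\<in>F'. ball c (r / 8))"
    unfolding compact_eq_totally_bounded by meson
  \<comment> \<open>Applying \<open>S \<tau> \<circ> B\<close> magnifies a distance to \<open>F\<close> or \<open>G\<close> by at most \<open>k\<close>; replacing the image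
     by a point of the net \<open>N\<close> costs another \<open>\<eta>\<close>.\<close>
  have net: "\<exists>c\<in>N. norm (S \<tau> (B x) - c) < k * q + \<eta>"
    if "\<tau> \<in> {0..T}" "c' \<in> F \<union> G" "dist c' x < q" for \<tau> x c' q
  proof -
    have "S \<tau> (B c') \<in> (\<Union>c\<in>N. ball c \<eta>)" using that N(2) by blast
    then obtain c where c: "c \<in> N" "dist c (S \<tau> (B c')) < \<eta>" by auto
    have "norm (S \<tau> (B (x - c'))) \<le> k * norm (x - c')"
      unfolding k_def by (intro norm_blinfun_apply2_le M that)
    also have "\<dots> \<le> k * q" using that k by (intro mult_left_mono) (auto simp: dist_norm norm_minus_commute)
    finally have "norm (S \<tau> (B x) - S \<tau> (B c')) \<le> k * q" by (simp add: blinfun.diff_right)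
    then have "norm (S \<tau> (B x) - c) < k * q + \<eta>"
      using c(2) norm_triangle_ineq[of "S \<tau> (B x) - S \<tau> (B c')" "S \<tau> (B c') - c"]
      by (simp add: dist_norm norm_minus_commute)
    with c show ?thesis by blast
  qed
  have "x \<in> (\<Union>c\<in>F'. ball c (3 / 4 * r))" if "x \<in> reachable S B \<psi>0 T L" for x
  proof -
    from that obtain \<psi> u t where x: "x = \<psi> t" and u: "u \<in> L1_loc"
      and \<psi>: "mild_solution_on {0..} S B u \<psi>0 \<psi>" and t: "t \<in> {0..T}" "control_mass u t < L"
      by (auto simp: reachable_def)
    from t have t0: "0 \<le> t" by simp
    obtain s0 where s0: "0 \<le> s0" "s0 \<le> t" "\<And>s. 0 \<le> s \<Longrightarrow> s < s0 \<Longrightarrow> control_mass u s < real j * \<epsilon>"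
      "control_mass u s0 \<le> real j * \<epsilon>" "control_mass u t - control_mass u s0 \<le> \<epsilon>"
      using ex_split_control_mass[OF u \<epsilon>(1) t0 t(2)[unfolded L_def]] by auto
    obtain y where y: "approx_integral (lebesgue_on {0..t}) (\<lambda>s. u s *\<^sub>R S (t - s) (B (\<psi> s))) y"
      "\<psi> t = S t \<psi>0 + y" by (rule mild_solution_on_approx_integral[OF \<psi> t0])
    define \<rho> where "\<rho> s = (if s < s0 then k * \<delta> + \<eta> else k * r + \<eta>)" for s
    have "\<exists>l. (\<forall>c\<in>N. \<bar>l c\<bar> \<le> (\<integral>s. \<bar>u s\<bar> \<partial>lebesgue_on {0..t})) \<and>
        norm (y - (\<Sum>c\<in>N. l c *\<^sub>R c)) \<le> (\<integral>s. \<bar>u s\<bar> * \<rho> s \<partial>lebesgue_on {0..t})"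
    proof (rule ex_bounded_combination_integral_near[OF L1_loc_integrable[OF u] y(1) N(1)])
      show "(\<lambda>s. norm (S (t - s) (B (\<psi> s)) - c)) \<in> borel_measurable (lebesgue_on {0..t})" for c
        by (intro continuous_imp_measurable_on_sets_lebesgue continuous_on_norm continuous_on_diff
            C0_semigroup_continuous_on_compose[OF C0] blinfun.continuous_on mild_solution_on_continuous[OF \<psi>]
            continuous_on_const) auto
      have [measurable]: "(\<lambda>s. s) \<in> borel_measurable (lebesgue_on {0..t})"
        using id_borel_measurable_lebesgue_on[of "{0..t}"] by (simp add: id_def)
      show "\<rho> \<in> borel_measurable (lebesgue_on {0..t})" unfolding \<rho>_def by measurable
      show "integrable (lebesgue_on {0..t}) (\<lambda>s. \<bar>u s\<bar> * \<rho> s)"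
        unfolding \<rho>_def by (rule integral_step_weight(1)[OF u s0(1,2)])
      fix s assume "s \<in> space (lebesgue_on {0..t})"
      then have s: "0 \<le> s" "s \<le> t" "s \<in> {0..T}" "t - s \<in> {0..T}" using t by auto
      show "\<exists>c\<in>N. norm (S (t - s) (B (\<psi> s)) - c) < \<rho> s"
      proof (cases "s < s0")
        case True
        then have "\<psi> s \<in> reachable S B \<psi>0 T (real j * \<epsilon>)"
          using s s0(3)[of s] by (intro reachableI[OF u \<psi>]) auto
        then obtain c' where "c' \<in> G" "dist c' (\<psi> s) < \<delta>" using G(2) by auto
        with net[OF s(4), of c' "\<psi> s" \<delta>] True show ?thesis by (simp add: \<rho>_def)
      next
        case False
        have "control_mass u s < L" using control_mass_mono[OF u s(2)] t by simp
        then have "\<psi> s \<in> reachable S B \<psi>0 T L"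
          using s by (intro reachableI[OF u \<psi>]) auto
        then obtain c' where "c' \<in> F" "dist c' (\<psi> s) < r" using F(2) by (auto simp: L_def)
        with net[OF s(4), of c' "\<psi> s" r] False show ?thesis by (simp add: \<rho>_def)
      qed
    qed
    then obtain l where l: "\<And>c. c \<in> N \<Longrightarrow> \<bar>l c\<bar> \<le> control_mass u t"
      "norm (y - (\<Sum>c\<in>N. l c *\<^sub>R c)) \<le> (\<integral>s. \<bar>u s\<bar> * \<rho> s \<partial>lebesgue_on {0..t})"
      unfolding control_mass_eq[OF u] by blast
    define z where "z = (\<Sum>c\<in>N. l c *\<^sub>R c)"
    have "(\<integral>s. \<bar>u s\<bar> * \<rho> s \<partial>lebesgue_on {0..t})
        = (k * \<delta> + \<eta>) * control_mass u s0 + (k * r + \<eta>) * (control_mass u t - control_mass u s0)"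
      unfolding \<rho>_def by (rule integral_step_weight(2)[OF u s0(1,2)])
    also have "\<dots> = k * \<delta> * control_mass u s0 + k * r * (control_mass u t - control_mass u s0) + \<eta> * control_mass u t"
      by (simp add: algebra_simps)
    also have "\<dots> \<le> k * \<delta> * L + k * r * \<epsilon> + \<eta> * L"
      using k \<delta> r \<eta> s0 jL t by (intro add_mono mult_left_mono) auto
    also have "\<dots> \<le> r / 16 + r / 2 + r / 16"
    proof -
      have "k * r * \<epsilon> = k * \<epsilon> * r" by simp
      also have "\<dots> \<le> r / 2" using mult_right_mono[OF k\<epsilon>, of r] r by simp
      finally show ?thesis using \<delta>L \<eta>L by simp
    qed
    finally have yz: "norm (y - z) \<le> 5 / 8 * r" using l(2) by (simp add: z_def)
    have "z \<in> Z" unfolding Z_def z_def using l(1) t(2) by force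
    then have "S t \<psi>0 + z \<in> {x + z | x z. x \<in> (\<lambda>\<tau>. S \<tau> \<psi>0) ` {0..T} \<and> z \<in> Z}"
      using t(1) by blast
    with F'(2) have "S t \<psi>0 + z \<in> (\<Union>c\<in>F'. ball c (r / 8))" by (rule subsetD)
    then obtain c where c: "c \<in> F'" "dist c (S t \<psi>0 + z) < r / 8" by auto
    have "dist (S t \<psi>0 + z) x = norm (y - z)"
      by (simp add: x y(2) dist_norm norm_minus_commute)
    then have "dist c x < 3 / 4 * r"
      using dist_triangle[of c x "S t \<psi>0 + z"] c(2) yz by simp
    with c show ?thesis by auto
  qed
  with F'(1) show ?thesis unfolding L_def by blast
qed

text \<open>A bounded set is covered by one ball, and the refinement multiplies the radius by \<open>3 / 4\<close> as
  often as desired.\<close>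

lemma reachable_totally_bounded_steps:
  fixes S :: "real \<Rightarrow> 'a::banach \<Rightarrow>\<^sub>L 'a"
  assumes C0: "C0_semigroup S"
    and M: "M \<ge> 0" "\<And>r. r \<in> {0..T} \<Longrightarrow> norm (S r) \<le> M"
    and \<epsilon>: "\<epsilon> > 0" "M * norm B * \<epsilon> \<le> 1 / 2"
  shows "totally_bounded (reachable S B \<psi>0 T (real j * \<epsilon>))"
proof (induction j)
  case 0
  have "reachable S B \<psi>0 T (real 0 * \<epsilon>) = {}"
    by (auto simp: reachable_def not_less control_mass_nonneg)
  then show ?case by simp
next
  case (Suc j)
  let ?R = "reachable S B \<psi>0 T (real (Suc j) * \<epsilon>)"
  obtain C where C: "\<And>x. x \<in> ?R \<Longrightarrow> norm x \<le> C" using reachable_bounded[where S = S, OF M \<epsilon>] by blast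
  define r0 where "r0 = \<bar>C\<bar> + 1"
  have r0: "r0 > 0" by (simp add: r0_def)
  have cover: "\<exists>F. finite F \<and> ?R \<subseteq> (\<Union>c\<in>F. ball c ((3 / 4) ^ n * r0))" for n
  proof (induction n)
    case 0
    show ?case using C by (intro exI[of _ "{0}"]) (fastforce simp: r0_def)
  next
    case (Suc n)
    then obtain F where "finite F" "?R \<subseteq> (\<Union>c\<in>F. ball c ((3 / 4) ^ n * r0))" by blast
    from reachable_refine_cover[OF C0 M \<epsilon> \<open>totally_bounded (reachable S B \<psi>0 T (real j * \<epsilon>))\<close> this] r0
    show ?case by (simp add: mult.assoc)
  qed
  show ?case
    unfolding totally_bounded_metric
  proof (intro allI impI)
    fix e :: real assume e: "e > 0"
    obtain n where n: "(3 / 4) ^ n < e / r0"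
      using real_arch_pow_inv[of "e / r0" "3 / 4"] e r0 by auto
    then have n': "(3 / 4) ^ n * r0 \<le> e" using r0 by (simp add: field_simps)
    obtain F where F: "finite F" "?R \<subseteq> (\<Union>c\<in>F. ball c ((3 / 4) ^ n * r0))" using cover by blast
    have "(\<Union>c\<in>F. ball c ((3 / 4) ^ n * r0)) \<subseteq> (\<Union>c\<in>F. {y. dist c y < e})"
      using n' by (intro UN_mono) auto
    from order_trans[OF F(2) this] F(1) show "\<exists>F. finite F \<and> ?R \<subseteq> (\<Union>c\<in>F. {y. dist c y < e})" by blast
  qed
qed

lemma reachable_totally_bounded:
  fixes S :: "real \<Rightarrow> 'a::banach \<Rightarrow>\<^sub>L 'a"
  assumes C0: "C0_semigroup S"
  shows "totally_bounded (reachable S B \<psi>0 T m)"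
proof -
  obtain M \<epsilon> where M: "M \<ge> 0" "\<And>r. r \<in> {0..T} \<Longrightarrow> norm (S r) \<le> M"
    and \<epsilon>: "\<epsilon> > 0" "M * norm B * \<epsilon> \<le> 1 / 2"
    using obtain_step_length[OF C0, where T = T and B = B] by blast
  obtain j where "m / \<epsilon> \<le> real j" using real_arch_simple by blast
  then have "m \<le> real j * \<epsilon>" using \<epsilon> by (simp add: field_simps)
  then have "reachable S B \<psi>0 T m \<subseteq> reachable S B \<psi>0 T (real j * \<epsilon>)"
    by (rule reachable_mono)
  moreover have "totally_bounded (reachable S B \<psi>0 T (real j * \<epsilon>))"
    by (rule reachable_totally_bounded_steps[OF C0 M(1) _ \<epsilon>]) (rule M(2))
  ultimately show ?thesis by (rule totally_bounded_subset[rotated])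
qed

section \<open>The attainable set\<close>

lemma compact_closure_totally_bounded:
  fixes R :: "'a::banach set"
  assumes "totally_bounded R"
  shows "compact (closure R)"
  unfolding compact_eq_totally_bounded
proof (intro conjI allI impI)
  show "complete (closure R)" by (simp add: complete_eq_closed)
  fix e :: real assume e: "e > 0"
  then have "e / 2 > 0" by simp
  with assms obtain F where F: "finite F" "R \<subseteq> (\<Union>c\<in>F. {y. dist c y < e / 2})"
    unfolding totally_bounded_metric by blast
  have "{y. dist c y < e / 2} \<subseteq> cball c (e / 2)" for c :: 'a by auto
  then have "R \<subseteq> (\<Union>c\<in>F. cball c (e / 2))" using F(2) by blast
  then have "closure R \<subseteq> (\<Union>c\<in>F. cball c (e / 2))"
    using F(1) by (intro closure_minimal closed_UN) auto
  also have "\<dots> \<subseteq> (\<Union>c\<in>F. ball c e)" using e by (intro UN_mono) auto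
  finally show "\<exists>F. finite F \<and> closure R \<subseteq> (\<Union>c\<in>F. ball c e)" using F(1) by blast
qed

text \<open>The value \<open>THE x. False\<close> is what the description yields when no mild solution exists. It is a
  single point, the same for all controls and times, so adding it to a compact set keeps the
  set compact.\<close>

lemma propagator_cases:
  fixes S :: "real \<Rightarrow> 'a::banach \<Rightarrow>\<^sub>L 'a"
  assumes C0: "C0_semigroup S" and u: "u \<in> L1_loc" and T: "0 \<le> T"
  shows "propagator S B u T \<psi>0 = (THE x. False) \<or>
    (\<exists>\<psi>. mild_solution_on {0..} S B u \<psi>0 \<psi> \<and> propagator S B u T \<psi>0 = \<psi> T)"
proof (cases "\<exists>\<psi>. mild_solution_on {0..} S B u \<psi>0 \<psi>")
  case True
  then obtain \<psi> where \<psi>: "mild_solution_on {0..} S B u \<psi>0 \<psi>" by blast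
  have "propagator S B u T \<psi>0 = \<psi> T"
    unfolding propagator_def
    by (rule the_equality) (use \<psi> mild_solution_on_unique[OF C0 u _ \<psi> T] in blast)+
  with \<psi> show ?thesis by blast
next
  case False
  then show ?thesis by (simp add: propagator_def)
qed

theorem theorem2:
  fixes D :: "'a::banach set"
    and A :: "'a \<Rightarrow> 'a"
    and S :: "real \<Rightarrow> 'a \<Rightarrow>\<^sub>L 'a"
    and B :: "'a \<Rightarrow>\<^sub>L 'a"
  assumes "linear_operator_on D A"
    and "generates_C0_semigroup D A S"
  shows "\<forall>\<psi>0. \<exists>K :: nat \<Rightarrow> 'a set. (\<forall>n. compact (K n)) \<and> attainable_set S B \<psi>0 L1_loc \<subseteq> (\<Union>n. K n)"
proof
  fix \<psi>0
  have C0: "C0_semigroup S" using assms(2) by (simp add: generates_C0_semigroup_def)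
  define K where "K n = insert (THE x. False) (closure (reachable S B \<psi>0 (real n) (real n)))" for n
  have "compact (K n)" for n
    unfolding K_def
    by (intro compact_insert compact_closure_totally_bounded reachable_totally_bounded C0)
  moreover have "propagator S B u T \<psi>0 \<in> (\<Union>n. K n)" if T: "0 \<le> T" and u: "u \<in> L1_loc" for T u
    using propagator_cases[OF C0 u T, of B \<psi>0]
  proof (elim disjE exE conjE)
    fix \<psi> assume \<psi>: "mild_solution_on {0..} S B u \<psi>0 \<psi>" and eq: "propagator S B u T \<psi>0 = \<psi> T"
    obtain n where n: "max T (control_mass u T) < real n" using reals_Archimedean2 by blast
    then have "\<psi> T \<in> reachable S B \<psi>0 (real n) (real n)"
      using T by (intro reachableI[OF u \<psi>]) auto
    then have "\<psi> T \<in> K n" using closure_subset by (auto simp: K_def)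
    then show ?thesis unfolding eq by blast
  qed (simp add: K_def)
  ultimately have "(\<forall>n. compact (K n)) \<and> attainable_set S B \<psi>0 L1_loc \<subseteq> (\<Union>n. K n)"
    by (auto simp: attainable_set_def)
  then show "\<exists>K :: nat \<Rightarrow> 'a set. (\<forall>n. compact (K n)) \<and> attainable_set S B \<psi>0 L1_loc \<subseteq> (\<Union>n. K n)"
    by (rule exI[of _ K])
qed

end
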